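(* For every $k\ge 1$ there is a constant $c_k>0$ such that the following holds. Let $P_1,\dots,P_k$ be oriented paths, each with at least one edge, and write $l_i=l(P_i)$ and $L_i=|P_i|-1$. Then $$l_1\cdots l_k\cdot \max_{i\in[k]}\frac{L_i}{l_i}\;\le\;\mathrm{RT}(P_1,\dots,P_k)\;\le\; c_k\cdot l_1\cdots l_k\cdot\max_{i\in[k]}\frac{L_i}{l_i}.$$
   Context: An oriented path is a path whose edges may be oriented arbitrarily, with no bidirected edges; $|P|$ is its number of vertices. For an oriented path $P$, $l(P)$ is the length (number of edges) of the longest directed subpath of $P$. A tournament is an oriented graph with exactly one edge between every pair of distinct vertices. $\mathrm{RT}(G_1,\dots,G_k)$ is the least $N$ such that in every tournament on $N$ vertices whose edges are coloured with colours $1,\dots,k$ there is an $i$ such that there is a copy (subgraph isomorphic as a directed graph) of $G_i$ all of whose edges have colour $i$. *)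

theory Defs
  imports Complex_Main
begin

text \<open>An oriented path with L edges is encoded by the list P of its edge orientations
  (length P = L): its vertices are 0,...,L and the i-th edge joins i and i+1, directed
  i -> i+1 if P!i is True and i+1 -> i otherwise. So |P| - 1 = length P.\<close>

definition path_len :: "bool list \<Rightarrow> nat" where
  "path_len P = length P"

definition directed_segment :: "bool list \<Rightarrow> nat \<Rightarrow> nat \<Rightarrow> bool" where
  "directed_segment P i j \<longleftrightarrow> i \<le> j \<and> j \<le> length P \<and>
     ((\<forall>t. i \<le> t \<and> t < j \<longrightarrow> P ! t) \<or> (\<forall>t. i \<le> t \<and> t < j \<longrightarrow> \<not> P ! t))"

definition longest_dir :: "bool list \<Rightarrow> nat" where
  "longest_dir P = Max {j - i | i j. directed_segment P i j}"

definition tournament :: "'a set \<Rightarrow> ('a \<Rightarrow> 'a \<Rightarrow> bool) \<Rightarrow> bool" where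
  "tournament V T \<longleftrightarrow>
     (\<forall>x y. T x y \<longrightarrow> x \<in> V \<and> y \<in> V) \<and>
     (\<forall>x\<in>V. \<not> T x x) \<and>
     (\<forall>x\<in>V. \<forall>y\<in>V. x \<noteq> y \<longrightarrow> (T x y \<longleftrightarrow> \<not> T y x))"

definition mono_copy ::
  "('a \<Rightarrow> 'a \<Rightarrow> bool) \<Rightarrow> ('a \<Rightarrow> 'a \<Rightarrow> nat) \<Rightarrow> nat \<Rightarrow> bool list \<Rightarrow> bool" where
  "mono_copy T col i P \<longleftrightarrow> (\<exists>f :: nat \<Rightarrow> 'a. inj_on f {0..length P} \<and>
     (\<forall>t < length P.
        (if P ! t then T (f t) (f (Suc t)) \<and> col (f t) (f (Suc t)) = i
                  else T (f (Suc t)) (f t) \<and> col (f (Suc t)) (f t) = i)))"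

definition ramsey_prop :: "bool list list \<Rightarrow> nat \<Rightarrow> bool" where
  "ramsey_prop Ps N \<longleftrightarrow>
     (\<forall>(T :: nat \<Rightarrow> nat \<Rightarrow> bool) (col :: nat \<Rightarrow> nat \<Rightarrow> nat).
        tournament {0..<N} T \<longrightarrow> (\<forall>x y. T x y \<longrightarrow> col x y < length Ps) \<longrightarrow>
        (\<exists>i < length Ps. mono_copy T col i (Ps ! i)))"

definition RT :: "bool list list \<Rightarrow> nat" where
  "RT Ps = (LEAST N. ramsey_prop Ps N)"

end

theory Submission
  imports Defs
begin

text \<open>Upper bound: shrink the vertex set and discard a colour i as long as some set containing a
  1/(64 k l_i) fraction of the vertices spans no edge of colour i. By the Gallai-Roy argument, in
  each surviving colour i every set with a 1/(64 k) fraction of the vertices then contains a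
  directed path on l_i vertices. A most popular surviving colour has sets A, B of vertices
  with large out-degree from A into B and large in-degree into B from A, and P_i is embedded greedily,
  its forward runs in A and its backward runs in B, a turn costing one edge between A and B.

  Lower bound: a transitive tournament in mixed radix notation, an edge being coloured by the
  most significant digit in which its ends differ.\<close>

section \<open>Directed paths in dense vertex sets (Gallai-Roy)\<close>

text \<open>Take a labelling of maximal sum among those in which each positive label drops by
  exactly one along some outgoing edge. As in the Gallai-Roy theorem, maximality makes every label
  class edge-free. If no label is large enough to give the path, one of \<open>l\<close> classes
  holds a \<open>1/l\<close> fraction of \<open>Q\<close> and so contains an edge, a
  contradiction.\<close>

lemma directed_path_of_dense:
  fixes R :: "'a \<Rightarrow> 'a \<Rightarrow> bool"
  assumes fin: "finite Q" and irr: "\<And>x. \<not> R x x" and "Q \<noteq> {}"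
    and edge: "\<And>W. W \<subseteq> Q \<Longrightarrow> card Q \<le> l * card W \<Longrightarrow> \<exists>u\<in>W. \<exists>v\<in>W. R u v"
  shows "\<exists>p. length p = l \<and> distinct p \<and> set p \<subseteq> Q \<and> successively R p"
proof -
  define supp where
    "supp c \<longleftrightarrow> (\<forall>v\<in>Q. c v > 0 \<longrightarrow> (\<exists>w\<in>Q. R v w \<and> c v = Suc (c w)))" for c :: "'a \<Rightarrow> nat"
  \<comment> \<open>Following supporting edges down to label 0 gives a path; the bound on its labels
    shows that the vertex prepended next is new.\<close>
  have path: "\<exists>p. length p = Suc (c v) \<and> distinct p \<and> set p \<subseteq> Q \<and> successively R p \<and> hd p = v
      \<and> (\<forall>x\<in>set p. c x \<le> c v)"
    if "supp c" "v \<in> Q" for c v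
    using that(2)
  proof (induction "c v" arbitrary: v)
    case 0
    then show ?case by (intro exI[of _ "[v]"]) auto
  next
    case (Suc n)
    then obtain w where w: "w \<in> Q" "R v w" "c v = Suc (c w)"
      using \<open>supp c\<close> unfolding supp_def by (metis zero_less_Suc)
    with Suc obtain p where p: "length p = Suc (c w)" "distinct p" "set p \<subseteq> Q"
      "successively R p" "hd p = w" "\<forall>x\<in>set p. c x \<le> c w"
      by (metis nat.inject)
    have "v \<notin> set p" using p(6) w(3) by auto
    then show ?case using p w Suc.prems
      by (intro exI[of _ "v # p"]) (auto simp: successively_Cons)
  qed
  have bound: "c v \<le> card Q" if "supp c" "v \<in> Q" for c v
    using path[OF that] fin by (metis Suc_leD card_mono distinct_card)
  have total: "sum c Q \<le> card Q * card Q" if "supp c" for c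
    using sum_bounded_above[of Q c "card Q"] bound[OF that] by simp
  \<comment> \<open>The zero labelling is supported and \<open>total\<close> bounds all sums, so a
    maximum exists.\<close>
  have "supp (\<lambda>_. 0)" by (simp add: supp_def)
  then have "\<exists>c. supp c \<and> (\<forall>c'. supp c' \<longrightarrow> sum c' Q \<le> sum c Q)"
    by (rule ex_has_greatest_nat[where f = "\<lambda>c. sum c Q" and b = "Suc (card Q * card Q)"])
      (simp add: total less_Suc_eq_le)
  then obtain c where c: "supp c" and cmax: "\<And>c'. supp c' \<Longrightarrow> sum c' Q \<le> sum c Q"
    by auto
  have proper: "\<not> R u v" if uv: "u \<in> Q" "v \<in> Q" "c u = c v" for u v
  proof
    assume "R u v"
    \<comment> \<open>\<open>E\<close> holds the edges along which the label drops by exactly one.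
      Raising the labels on \<open>S\<close>, the vertices reaching \<open>u\<close> through
      \<open>E\<close>, keeps the labelling supported: \<open>u\<close> is now supported by
      \<open>v\<close>, which lies outside \<open>S\<close>, and any other vertex of
      \<open>S\<close> by its successor on a path to \<open>u\<close>.\<close>
    define E where "E = {(w, x). w \<in> Q \<and> x \<in> Q \<and> R w x \<and> c w = Suc (c x)}"
    define S where "S = {w. (w, u) \<in> E\<^sup>*}"
    have mono: "c w > c u \<or> w = u" if "(w, u) \<in> E\<^sup>*" for w
      using that
    proof (induction rule: converse_rtrancl_induct)
      case (step w x)
      then have "c w = Suc (c x)" by (simp add: E_def)
      then show ?case using step.IH by auto
    qed simp
    have "v \<noteq> u" using \<open>R u v\<close> irr by auto
    then have "v \<notin> S" using mono[of v] uv(3) by (auto simp: S_def)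
    have "u \<in> S" by (simp add: S_def)
    define c' where "c' x = (if x \<in> S then Suc (c x) else c x)" for x
    have "supp c'" unfolding supp_def
    proof (intro ballI impI)
      fix w assume w: "w \<in> Q" "c' w > 0"
      show "\<exists>x\<in>Q. R w x \<and> c' w = Suc (c' x)"
      proof (cases "w \<in> S")
        case True
        show ?thesis
        proof (cases "w = u")
          case True
          then show ?thesis using \<open>R u v\<close> \<open>v \<notin> S\<close> \<open>u \<in> S\<close> uv
            by (intro bexI[of _ v]) (simp_all add: c'_def)
        next
          case False
          with True obtain x where "(w, x) \<in> E" "(x, u) \<in> E\<^sup>*"
            unfolding S_def by (auto elim: converse_rtranclE)
          then have "x \<in> Q" "R w x" "c w = Suc (c x)" "x \<in> S" by (simp_all add: E_def S_def)
          then show ?thesis using True by (intro bexI[of _ x]) (simp_all add: c'_def)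
        qed
      next
        case False
        then obtain x where x: "x \<in> Q" "R w x" "c w = Suc (c x)"
          using w c unfolding supp_def c'_def by auto
        \<comment> \<open>A supporter in \<open>S\<close> would have pulled \<open>w\<close> into
          \<open>S\<close>, so its label is unchanged.\<close>
        then have "(w, x) \<in> E" using w by (simp add: E_def)
        then have "x \<in> S \<Longrightarrow> w \<in> S"
          unfolding S_def by (simp add: converse_rtrancl_into_rtrancl)
        then have "x \<notin> S" using False by blast
        then show ?thesis using x False by (intro bexI[of _ x]) (simp_all add: c'_def)
      qed
    qed
    moreover have "sum c Q < sum c' Q"
    proof (rule sum_strict_mono_ex1[OF fin])
      show "\<exists>x\<in>Q. c x < c' x" using uv(1) \<open>u \<in> S\<close> by (intro bexI[of _ u]) (simp_all add: c'_def)
    qed (simp add: c'_def)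
    ultimately show False using cmax[of c'] by linarith
  qed
  show ?thesis
  proof (cases "\<exists>v\<in>Q. l \<le> Suc (c v)")
    case True
    then obtain v where v: "v \<in> Q" "l \<le> Suc (c v)" by blast
    obtain p where p: "length p = Suc (c v)" "distinct p" "set p \<subseteq> Q" "successively R p"
      using path[OF c v(1)] by blast
    have "successively R (take l p)"
      using p(4) successively_append_iff[of R "take l p" "drop l p"] by simp
    then show ?thesis using p v set_take_subset[of l p] by (intro exI[of _ "take l p"]) auto
  next
    case False
    then have small: "c v < l" if "v \<in> Q" for v using that by force
    have "\<exists>j<l. card Q \<le> l * card {v \<in> Q. c v = j}"
    proof (rule ccontr)
      assume "\<not> ?thesis"
      then have less: "l * card {v \<in> Q. c v = j} < card Q" if "j < l" for j using that by force
      have "l > 0" using small \<open>Q \<noteq> {}\<close> by fastforce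
      have "Q = (\<Union>j<l. {v \<in> Q. c v = j})" using small by auto
      then have "card Q \<le> (\<Sum>j<l. card {v \<in> Q. c v = j})"
        using card_UN_le[of "{..<l}" "\<lambda>j. {v \<in> Q. c v = j}"] by simp
      then have "l * card Q \<le> (\<Sum>j<l. l * card {v \<in> Q. c v = j})"
        unfolding sum_distrib_left[symmetric] by (rule mult_le_mono2)
      also have "\<dots> < (\<Sum>j<l. card Q)"
        by (rule sum_strict_mono) (use less \<open>l > 0\<close> in auto)
      finally show False by simp
    qed
    then obtain j where "card Q \<le> l * card {v \<in> Q. c v = j}" by blast
    then obtain u v where "u \<in> Q" "v \<in> Q" "c u = j" "c v = j" "R u v"
      using edge[of "{v \<in> Q. c v = j}"] by auto
    then show ?thesis using proper by simp
  qed
qed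

section \<open>Subgraphs of large minimum degree\<close>

text \<open>Among pairs with more than \<open>t * (card A + card B)\<close> edges from
  \<open>A\<close> to \<open>B\<close>, take one of least total size: deleting a vertex of degree
  below \<open>t\<close> would preserve the inequality. The sets may overlap, so
  \<open>(U, U)\<close> is an admissible start.\<close>

lemma min_degree_subgraph:
  fixes R :: "'a \<Rightarrow> 'a \<Rightarrow> bool"
  assumes fin: "finite U" and many: "2 * t * card U < card {(u, v) \<in> U \<times> U. R u v}"
  shows "\<exists>A B. A \<subseteq> U \<and> B \<subseteq> U \<and> A \<noteq> {} \<and> B \<noteq> {} \<and>
    (\<forall>a\<in>A. t \<le> card {b \<in> B. R a b}) \<and> (\<forall>b\<in>B. t \<le> card {a \<in> A. R a b})"
proof -
  define e where "e A B = card {(u, v) \<in> A \<times> B. R u v}" for A B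
  define P where "P AB \<longleftrightarrow> fst AB \<subseteq> U \<and> snd AB \<subseteq> U \<and>
    t * (card (fst AB) + card (snd AB)) < e (fst AB) (snd AB)" for AB
  have "P (U, U)" using many by (simp add: P_def e_def algebra_simps)
  from ex_has_least_nat[of P, OF this, of "\<lambda>(A, B). card A + card B"]
  obtain A B where AB: "P (A, B)"
    and least: "\<And>A' B'. P (A', B') \<Longrightarrow> card A + card B \<le> card A' + card B'"
    by (auto split: prod.splits)
  have sub: "A \<subseteq> U" "B \<subseteq> U" and ineq: "t * (card A + card B) < e A B"
    using AB by (auto simp: P_def)
  have finAB: "finite A" "finite B" using sub fin finite_subset by auto
  have "t \<le> card {b \<in> B. R a b}" if "a \<in> A" for a
  proof (rule ccontr)
    assume less: "\<not> ?thesis"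
    have "{(u, v) \<in> A \<times> B. R u v} \<subseteq>
        {(u, v) \<in> (A - {a}) \<times> B. R u v} \<union> Pair a ` {b \<in> B. R a b}" by auto
    then have "e A B \<le> card ({(u, v) \<in> (A - {a}) \<times> B. R u v} \<union> Pair a ` {b \<in> B. R a b})"
      unfolding e_def by (intro card_mono) (use finAB in \<open>auto intro: finite_subset[of _ "A \<times> B"]\<close>)
    also have "\<dots> \<le> e (A - {a}) B + card {b \<in> B. R a b}"
      unfolding e_def
      by (rule order_trans[OF card_Un_le]) (use finAB in \<open>simp add: card_image_le\<close>)
    finally have "t * (card A + card B) < e (A - {a}) B + t" using ineq less by linarith
    moreover have ca: "card A = Suc (card (A - {a}))" by (rule card.remove[OF finAB(1) that])
    ultimately have "t * (card (A - {a}) + card B) < e (A - {a}) B"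
      by (simp only: ca add_Suc mult_Suc_right)
    then have "P (A - {a}, B)" unfolding P_def fst_conv snd_conv using sub by blast
    from least[OF this] ca show False by linarith
  qed
  moreover have "t \<le> card {a \<in> A. R a b}" if "b \<in> B" for b
  proof (rule ccontr)
    assume less: "\<not> ?thesis"
    have "{(u, v) \<in> A \<times> B. R u v} \<subseteq>
        {(u, v) \<in> A \<times> (B - {b}). R u v} \<union> (\<lambda>a. (a, b)) ` {a \<in> A. R a b}" by auto
    then have "e A B \<le> card ({(u, v) \<in> A \<times> (B - {b}). R u v} \<union> (\<lambda>a. (a, b)) ` {a \<in> A. R a b})"
      unfolding e_def by (intro card_mono) (use finAB in \<open>auto intro: finite_subset[of _ "A \<times> B"]\<close>)
    also have "\<dots> \<le> e A (B - {b}) + card {a \<in> A. R a b}"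
      unfolding e_def
      by (rule order_trans[OF card_Un_le]) (use finAB in \<open>simp add: card_image_le\<close>)
    finally have "t * (card A + card B) < e A (B - {b}) + t" using ineq less by linarith
    moreover have cb: "card B = Suc (card (B - {b}))" by (rule card.remove[OF finAB(2) that])
    ultimately have "t * (card A + card (B - {b})) < e A (B - {b})"
      by (simp only: cb add_Suc_right mult_Suc_right)
    then have "P (A, B - {b})" unfolding P_def fst_conv snd_conv using sub by blast
    from least[OF this] cb show False by linarith
  qed
  moreover have "A \<noteq> {}" "B \<noteq> {}" using ineq by (auto simp: e_def)
  ultimately show ?thesis using sub by blast
qed

section \<open>Greedy embedding along runs\<close>

text \<open>Runs are list factors instead of index intervals, so that the bound passes to tails
  directly.\<close>

definition runs_le :: "nat \<Rightarrow> bool list \<Rightarrow> bool" where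
  "runs_le l xs \<longleftrightarrow> (\<forall>ys m d zs. xs = ys @ replicate m d @ zs \<longrightarrow> m \<le> l)"

lemma runs_le_Cons: "runs_le l (x # xs) \<Longrightarrow> runs_le l xs"
  unfolding runs_le_def by (metis append_Cons)

lemma runs_le_takeWhile:
  assumes "runs_le l xs" shows "length (takeWhile (\<lambda>x. x = d) xs) \<le> l"
proof -
  let ?t = "takeWhile (\<lambda>x. x = d) xs"
  have "?t = replicate (length ?t) d"
    by (rule replicate_eqI) (auto dest: set_takeWhileD)
  then have "xs = [] @ replicate (length ?t) d @ dropWhile (\<lambda>x. x = d) xs"
    by (metis append_Nil takeWhile_dropWhile_id)
  then show ?thesis using assms unfolding runs_le_def by blast
qed

text \<open>The orientation is a parameter, so that forward and backward runs share one
  argument.\<close>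

fun step :: "('a \<Rightarrow> 'a \<Rightarrow> bool) \<Rightarrow> bool \<Rightarrow> 'a \<Rightarrow> 'a \<Rightarrow> bool" where
  "step R True u v = R u v"
| "step R False u v = R v u"

text \<open>The list ds reserves vertices for the rest of the current run; at a turn a fresh directed
  path is found inside the neighbourhood of the current vertex, which is then adjacent to its head.\<close>

lemma embed_runs:
  fixes R :: "'a \<Rightarrow> 'a \<Rightarrow> bool" and X :: "bool \<Rightarrow> 'a set"
  assumes finX: "\<And>d. finite (X d)"
    and deg: "\<And>d v. v \<in> X d \<Longrightarrow> q + L \<le> card {w \<in> X (\<not> d). step R d v w}"
    and path: "\<And>d Q. Q \<subseteq> X d \<Longrightarrow> q \<le> card Q \<Longrightarrow>
      \<exists>p. length p = l \<and> distinct p \<and> set p \<subseteq> Q \<and> successively (step R d) p"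
    and "l \<ge> 1"
  shows "runs_le l xs \<Longrightarrow> ds \<noteq> [] \<Longrightarrow> distinct ds \<Longrightarrow> set ds \<subseteq> X d \<Longrightarrow>
    successively (step R d) ds \<Longrightarrow> (xs \<noteq> [] \<longrightarrow> hd xs = d) \<Longrightarrow>
    length (takeWhile (\<lambda>x. x = d) xs) \<le> length ds \<Longrightarrow> finite F \<Longrightarrow> F \<inter> set ds = {} \<Longrightarrow>
    card F + length xs \<le> L \<Longrightarrow>
    \<exists>vs. length vs = Suc (length xs) \<and> hd vs = hd ds \<and> distinct vs \<and> set vs \<inter> F = {} \<and>
      (\<forall>t < length xs. step R (xs ! t) (vs ! t) (vs ! Suc t))"
proof (induction xs arbitrary: d ds F)
  case Nil
  then show ?case by (intro exI[of _ "[hd ds]"]) (auto simp: disjoint_iff)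
next
  case (Cons x xs)
  have x: "x = d" using Cons.prems by simp
  obtain v ds1 where ds: "ds = v # ds1" using Cons.prems(2) by (cases ds) auto
  have vX: "v \<in> X d" and vF: "v \<notin> F" using Cons.prems ds by auto
  have cF: "card (insert v F) = Suc (card F)" using vF Cons.prems by simp
  \<comment> \<open>\<open>F\<close> collects the vertices used so far; a continuation avoiding
    \<open>v\<close> and \<open>F\<close> gets \<open>v\<close> prepended.\<close>
  have extend: ?case
    if "length vs = Suc (length xs)" "distinct vs" "set vs \<inter> insert v F = {}"
      "\<forall>t < length xs. step R (xs ! t) (vs ! t) (vs ! Suc t)" "step R d v (hd vs)" for vs
  proof (intro exI[of _ "v # vs"] conjI allI impI)
    fix t assume t: "t < length (x # xs)"
    show "step R ((x # xs) ! t) ((v # vs) ! t) ((v # vs) ! Suc t)"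
    proof (cases t)
      case 0
      then show ?thesis using that x by (cases vs) auto
    next
      case (Suc n)
      then show ?thesis using that t by simp
    qed
  qed (use that ds vF in auto)
  show ?case
  proof (cases "xs \<noteq> [] \<and> hd xs = d")
    case True
    \<comment> \<open>The run goes on after the current edge, so the next vertex is the next
      reserved one.\<close>
    then have "2 \<le> length (takeWhile (\<lambda>y. y = d) (x # xs))" using x by (cases xs) auto
    then have "2 \<le> length ds" using Cons.prems(7) by linarith
    then obtain w ds2 where ds1: "ds1 = w # ds2" using ds by (cases ds1) auto
    have "\<exists>vs. length vs = Suc (length xs) \<and> hd vs = hd ds1 \<and> distinct vs \<and>
        set vs \<inter> insert v F = {} \<and> (\<forall>t < length xs. step R (xs ! t) (vs ! t) (vs ! Suc t))"
      by (rule Cons.IH[where d = d])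
        (use Cons.prems ds ds1 x True cF in \<open>auto simp: runs_le_Cons[of l x]\<close>)
    then show ?thesis using extend Cons.prems(5) ds ds1 by auto
  next
    case False
    \<comment> \<open>The current edge is the last of its run and already crosses to the other side,
      so a run of \<open>m\<close> edges needs only \<open>m\<close> vertices in \<open>X d\<close>,
      and a path on \<open>l\<close> vertices suffices. The surplus \<open>L\<close> in
      \<open>deg\<close> pays for the used vertices.\<close>
    define Q where "Q = {w \<in> X (\<not> d). step R d v w} - insert v F"
    have "card {w \<in> X (\<not> d). step R d v w} - card (insert v F) \<le> card Q"
      unfolding Q_def by (rule diff_card_le_card_Diff) (use Cons.prems in simp)
    then have "q \<le> card Q" using deg[OF vX] cF Cons.prems(10) by simp
    then obtain p where p: "length p = l" "distinct p" "set p \<subseteq> Q" "successively (step R (\<not> d)) p"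
      using path[of Q "\<not> d"] by (auto simp: Q_def)
    have "p \<noteq> []" using p \<open>l \<ge> 1\<close> by auto
    have "\<exists>vs. length vs = Suc (length xs) \<and> hd vs = hd p \<and> distinct vs \<and>
        set vs \<inter> insert v F = {} \<and> (\<forall>t < length xs. step R (xs ! t) (vs ! t) (vs ! Suc t))"
    proof (rule Cons.IH[where d = "\<not> d"])
      show "runs_le l xs" using Cons.prems(1) runs_le_Cons by blast
      then show "length (takeWhile (\<lambda>x. x = (\<not> d)) xs) \<le> length p"
        using runs_le_takeWhile p(1) by blast
      show "set p \<subseteq> X (\<not> d)" "insert v F \<inter> set p = {}" using p(3) by (auto simp: Q_def)
      show "card (insert v F) + length xs \<le> L" using cF Cons.prems(10) by simp
    qed (use False p \<open>p \<noteq> []\<close> Cons.prems in auto)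
    moreover have "step R d v (hd p)" using p(3) hd_in_set[OF \<open>p \<noteq> []\<close>] by (auto simp: Q_def)
    ultimately show ?thesis using extend by metis
  qed
qed

section \<open>Eliminating sparse colours and choosing a popular one\<close>

text \<open>If a colour \<open>i\<close> misses some \<open>W\<close> with
  \<open>card V \<le> g i * card W\<close>, pass to \<open>W\<close> and drop \<open>i\<close> for
  good. Each dropped colour costs its factor \<open>g i\<close> once; the process stops when every
  remaining colour is dense.\<close>

lemma colour_reduction:
  fixes g :: "nat \<Rightarrow> nat"
  assumes "finite J" and "\<forall>x\<in>V. \<forall>y\<in>V. T x y \<longrightarrow> col x y \<in> J"
  shows "\<exists>U I. U \<subseteq> V \<and> I \<subseteq> J \<and> card V \<le> card U * (\<Prod>i\<in>J - I. g i) \<and>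
    (\<forall>x\<in>U. \<forall>y\<in>U. T x y \<longrightarrow> col x y \<in> I) \<and>
    (\<forall>i\<in>I. \<forall>W\<subseteq>U. card U \<le> g i * card W \<longrightarrow> (\<exists>u\<in>W. \<exists>v\<in>W. T u v \<and> col u v = i))"
  using assms
proof (induction J arbitrary: V rule: finite_psubset_induct)
  case (psubset J)
  show ?case
  proof (cases "\<forall>i\<in>J. \<forall>W\<subseteq>V. card V \<le> g i * card W \<longrightarrow>
      (\<exists>u\<in>W. \<exists>v\<in>W. T u v \<and> col u v = i)")
    case True
    then show ?thesis using psubset.prems by (intro exI[of _ V] exI[of _ J]) simp
  next
    case False
    then obtain i W where i: "i \<in> J" "W \<subseteq> V" "card V \<le> g i * card W"
      and none: "\<forall>u\<in>W. \<forall>v\<in>W. T u v \<longrightarrow> col u v \<noteq> i" by blast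
    have "J - {i} \<subset> J" using i by blast
    moreover have "\<forall>x\<in>W. \<forall>y\<in>W. T x y \<longrightarrow> col x y \<in> J - {i}"
      using none psubset.prems i(2) by blast
    ultimately obtain U I where U: "U \<subseteq> W" "I \<subseteq> J - {i}"
      "card W \<le> card U * (\<Prod>j\<in>J - {i} - I. g j)"
      "\<forall>x\<in>U. \<forall>y\<in>U. T x y \<longrightarrow> col x y \<in> I"
      "\<forall>i\<in>I. \<forall>W\<subseteq>U. card U \<le> g i * card W \<longrightarrow> (\<exists>u\<in>W. \<exists>v\<in>W. T u v \<and> col u v = i)"
      using psubset.IH[of "J - {i}" W] by auto
    have "J - I = insert i (J - {i} - I)" using i U by blast
    then have "(\<Prod>j\<in>J - I. g j) = g i * (\<Prod>j\<in>J - {i} - I. g j)"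
      using psubset.hyps by simp
    moreover have "g i * card W \<le> g i * (card U * (\<Prod>j\<in>J - {i} - I. g j))"
      using U(3) by (rule mult_le_mono2)
    ultimately have "card V \<le> card U * (\<Prod>j\<in>J - I. g j)" using i(3) by (metis le_trans mult.left_commute)
    moreover have "U \<subseteq> V" "I \<subseteq> J" using U(1,2) i(2) by auto
    ultimately show ?thesis using U(4,5)
      by - (rule exI[of _ U], rule exI[of _ I], intro conjI, assumption+)
  qed
qed

text \<open>For \<open>n = card U\<close> at least 2 there are at least
  \<open>n * (n - 1) / 2\<close>, hence \<open>n^2 / 4\<close>, edges, and some colour takes a
  \<open>1/k\<close> share.\<close>

lemma popular_colour:
  fixes col :: "'a \<Rightarrow> 'a \<Rightarrow> nat"
  assumes fin: "finite U" and two: "2 \<le> card U"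
    and total: "\<forall>x\<in>U. \<forall>y\<in>U. x \<noteq> y \<longrightarrow> T x y \<or> T y x"
    and col: "\<forall>x\<in>U. \<forall>y\<in>U. T x y \<longrightarrow> col x y \<in> I" and "finite I" "card I \<le> k" "1 \<le> k"
  shows "\<exists>i\<in>I. card U * card U \<le> 4 * k * card {(u, v) \<in> U \<times> U. T u v \<and> col u v = i}"
proof (rule ccontr)
  let ?n = "card U"
  define e where "e i = card {(u, v) \<in> U \<times> U. T u v \<and> col u v = i}" for i
  define E where "E = {(u, v) \<in> U \<times> U. T u v}"
  assume "\<not> ?thesis"
  then have less: "4 * k * e i < ?n * ?n" if "i \<in> I" for i using that by (force simp: e_def)
  have pos: "0 < ?n * ?n" using two by simp
  have "E = (\<Union>i\<in>I. {(u, v) \<in> U \<times> U. T u v \<and> col u v = i})" using col by (auto simp: E_def)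
  then have "card E \<le> (\<Sum>i\<in>I. e i)" unfolding e_def by (simp only: card_UN_le[OF \<open>finite I\<close>])
  then have "4 * k * card E \<le> (\<Sum>i\<in>I. 4 * k * e i)"
    unfolding sum_distrib_left[symmetric] by (rule mult_le_mono2)
  \<comment> \<open>Subtracting 1 keeps the estimate weak, so an empty \<open>I\<close> needs no
    separate case; strictness returns below from \<open>1 \<le> k\<close>.\<close>
  also have "\<dots> \<le> card I * (?n * ?n - 1)"
  proof -
    have "4 * k * e i \<le> ?n * ?n - 1" if "i \<in> I" for i using less[OF that] by linarith
    then show ?thesis using sum_bounded_above[of I "\<lambda>i. 4 * k * e i" "?n * ?n - 1"] by simp
  qed
  also have "\<dots> \<le> k * (?n * ?n - 1)" using \<open>card I \<le> k\<close> by (rule mult_le_mono1)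
  also have "\<dots> < k * (?n * ?n)" using pos \<open>1 \<le> k\<close> by simp
  finally have "k * (4 * card E) < k * (?n * ?n)" by (simp add: ac_simps)
  then have E: "4 * card E < ?n * ?n" by simp
  have finE: "finite E" unfolding E_def by (rule finite_subset[of _ "U \<times> U"]) (use fin in auto)
  have "U \<times> U \<subseteq> ((\<lambda>x. (x, x)) ` U \<union> E) \<union> prod.swap ` E"
    using total by (force simp: E_def image_iff)
  then have "card (U \<times> U) \<le> card (((\<lambda>x. (x, x)) ` U \<union> E) \<union> prod.swap ` E)"
    by (intro card_mono) (use fin finE in auto)
  also have "\<dots> \<le> card ((\<lambda>x. (x, x)) ` U \<union> E) + card (prod.swap ` E)" by (rule card_Un_le)
  also have "\<dots> \<le> card ((\<lambda>x. (x, x)) ` U) + card E + card (prod.swap ` E)"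
    by (intro add_right_mono card_Un_le)
  also have "\<dots> \<le> ?n + card E + card E"
    by (intro add_mono card_image_le fin finE order_refl)
  finally have "?n * ?n \<le> ?n + 2 * card E" by (simp add: card_cartesian_product)
  moreover have "2 * ?n \<le> ?n * ?n" using two by simp
  ultimately show False using E by linarith
qed

section \<open>Embedding in one dense colour\<close>

text \<open>\<open>min_degree_subgraph\<close> supplies the two sides and
  \<open>directed_path_of_dense\<close> the path for each run; for \<open>embed_runs\<close> it
  remains to fit the constants.\<close>

lemma embed_in_dense_colour:
  fixes R :: "'a \<Rightarrow> 'a \<Rightarrow> bool"
  assumes fin: "finite U" and irr: "\<And>x. \<not> R x x"
    and many: "card U * card U \<le> 4 * k * card {(u, v) \<in> U \<times> U. R u v}"
    and dense: "\<And>W. W \<subseteq> U \<Longrightarrow> card U \<le> 64 * k * l * card W \<Longrightarrow> \<exists>u\<in>W. \<exists>v\<in>W. R u v"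
    and large: "128 * k * length P \<le> card U"
    and "P \<noteq> []" "runs_le l P" "1 \<le> l" "1 \<le> k"
  shows "\<exists>vs. length vs = Suc (length P) \<and> distinct vs \<and>
    (\<forall>t < length P. step R (P ! t) (vs ! t) (vs ! Suc t))"
proof -
  define n where "n = card U"
  \<comment> \<open>\<open>q\<close> is the least integer above \<open>n / (64 * k)\<close>, so that
    \<open>dense\<close> gives a path on \<open>l\<close> vertices in any \<open>q\<close> vertices
    of a side. There are at least \<open>4 * t * n\<close> edges, double what
    \<open>min_degree_subgraph\<close> asks to be exceeded, and \<open>t\<close> is at least
    \<open>4 * (q - 1)\<close>, which leaves room for the at most \<open>(q - 1) / 2\<close> edges
    of \<open>P\<close>.\<close>
  define q where "q = n div (64 * k) + 1"
  define t where "t = n div (16 * k)"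
  have L: "1 \<le> length P" using \<open>P \<noteq> []\<close> by (simp add: Suc_leI)
  have "2 * length P = 128 * k * length P div (64 * k)" using \<open>1 \<le> k\<close> by simp
  also have "\<dots> \<le> n div (64 * k)" using large by (intro div_le_mono) (simp add: n_def)
  finally have a: "2 * length P \<le> n div (64 * k)" .
  have "4 * (n div (64 * k)) * (16 * k) = n div (64 * k) * (64 * k)" by simp
  also have "\<dots> \<le> n" by (rule div_times_less_eq_dividend)
  finally have "4 * (n div (64 * k)) \<le> t"
    unfolding t_def using \<open>1 \<le> k\<close> by (simp add: less_eq_div_iff_mult_less_eq)
  then have qt: "q + length P \<le> t" using a L unfolding q_def by linarith
  have "n * (16 * k * t) \<le> n * n" unfolding t_def by (intro mult_le_mono2) simp
  also have "\<dots> \<le> 4 * k * card {(u, v) \<in> U \<times> U. R u v}" using many by (simp add: n_def)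
  finally have "4 * k * (4 * t * n) \<le> 4 * k * card {(u, v) \<in> U \<times> U. R u v}"
    by (simp add: ac_simps)
  then have "4 * t * n \<le> card {(u, v) \<in> U \<times> U. R u v}"
    using \<open>1 \<le> k\<close> by (simp add: ac_simps)
  moreover have "0 < t * n"
  proof -
    have "0 < t" using qt L by linarith
    moreover have "0 < n"
    proof (rule ccontr)
      assume "\<not> 0 < n"
      with a L show False by simp
    qed
    ultimately show ?thesis by simp
  qed
  ultimately have "2 * t * card U < card {(u, v) \<in> U \<times> U. R u v}"
    unfolding n_def mult.assoc by linarith
  from min_degree_subgraph[OF fin this] obtain A B where AB: "A \<subseteq> U" "B \<subseteq> U" "A \<noteq> {}" "B \<noteq> {}"
    "\<forall>a\<in>A. t \<le> card {b \<in> B. R a b}" "\<forall>b\<in>B. t \<le> card {a \<in> A. R a b}"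
    by (elim exE conjE)
  \<comment> \<open>Forward runs live in \<open>A\<close>, backward runs in \<open>B\<close>; with
    \<open>step\<close> the two degree conditions become the single \<open>deg\<close>.\<close>
  define X where "X d = (if d then A else B)" for d
  have XU: "X d \<subseteq> U" and Xne: "X d \<noteq> {}" for d using AB by (simp_all add: X_def)
  have finX: "finite (X d)" for d using XU fin by (rule finite_subset)
  have deg: "q + length P \<le> card {w \<in> X (\<not> d). step R d v w}" if "v \<in> X d" for d v
    using AB that qt by (cases d) (auto simp: X_def intro: order_trans)
  have path: "\<exists>p. length p = l \<and> distinct p \<and> set p \<subseteq> Q \<and> successively (step R d) p"
    if Q: "Q \<subseteq> X d" "q \<le> card Q" for d Q
  proof (rule directed_path_of_dense)
    show "finite Q" using Q finX by (blast intro: finite_subset)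
    show "Q \<noteq> {}" using Q(2) by (auto simp: q_def)
    show "\<not> step R d x x" for x using irr by (cases d) auto
    fix W assume W: "W \<subseteq> Q" "card Q \<le> l * card W"
    have "n < 64 * k * q" using \<open>1 \<le> k\<close> dividend_less_times_div[of "64 * k" n] by (simp add: q_def)
    also have "\<dots> \<le> 64 * k * card Q" using Q(2) by (rule mult_le_mono2)
    also have "\<dots> \<le> 64 * k * (l * card W)" using W(2) by (rule mult_le_mono2)
    finally have "card U \<le> 64 * k * l * card W" by (simp add: n_def mult.assoc)
    moreover have "W \<subseteq> U" using W(1) Q(1) XU by blast
    ultimately obtain u v where "u \<in> W" "v \<in> W" "R u v" using dense by blast
    then show "\<exists>u\<in>W. \<exists>v\<in>W. step R d u v" by (cases d) auto
  qed
  define d where "d = hd P"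
  \<comment> \<open>A neighbourhood seen from the other side shows that \<open>X d\<close> has at
    least \<open>q\<close> vertices, enough for the path serving the first run.\<close>
  obtain v where "v \<in> X (\<not> d)" using Xne by blast
  from deg[OF this] have "q \<le> card {w \<in> X d. step R (\<not> d) v w}" by simp
  also have "\<dots> \<le> card (X d)" by (intro card_mono finX) auto
  finally obtain ds where ds: "length ds = l" "distinct ds" "set ds \<subseteq> X d"
    "successively (step R d) ds"
    using path[of "X d" d] by auto
  have "\<exists>vs. length vs = Suc (length P) \<and> hd vs = hd ds \<and> distinct vs \<and> set vs \<inter> {} = {} \<and>
      (\<forall>t < length P. step R (P ! t) (vs ! t) (vs ! Suc t))"
  proof (rule embed_runs[where X = X and q = q and L = "length P" and l = l and d = d])
    show "length (takeWhile (\<lambda>x. x = d) P) \<le> length ds"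
      using runs_le_takeWhile \<open>runs_le l P\<close> ds(1) by blast
  qed (use finX deg path ds assms(7,8) in \<open>auto simp: d_def\<close>)
  then show ?thesis by blast
qed

section \<open>The longest directed subpath\<close>

lemma longest_dir_ge: "directed_segment P i j \<Longrightarrow> j - i \<le> longest_dir P"
  unfolding longest_dir_def
proof (rule Max_ge)
  have "{j - i |i j. directed_segment P i j} \<subseteq> {..length P}"
    by (auto simp: directed_segment_def)
  then show "finite {j - i |i j. directed_segment P i j}" by (rule finite_subset) simp
qed auto

lemma longest_dir_attained: "\<exists>i j. directed_segment P i j \<and> longest_dir P = j - i"
proof -
  have "{j - i |i j. directed_segment P i j} \<subseteq> {..length P}"
    by (auto simp: directed_segment_def)
  then have "finite {j - i |i j. directed_segment P i j}" by (rule finite_subset) simp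
  moreover have "directed_segment P 0 0" by (simp add: directed_segment_def)
  ultimately have "longest_dir P \<in> {j - i |i j. directed_segment P i j}"
    unfolding longest_dir_def by (intro Max_in) auto
  then show ?thesis by auto
qed

lemma longest_dir_le_length: "longest_dir P \<le> length P"
  using longest_dir_attained[of P] by (auto simp: directed_segment_def)

lemma longest_dir_pos: "P \<noteq> [] \<Longrightarrow> 1 \<le> longest_dir P"
  using longest_dir_ge[of P 0 1] by (auto simp: directed_segment_def Suc_le_eq)

lemma runs_le_longest_dir: "runs_le (longest_dir P) P"
  unfolding runs_le_def
proof (intro allI impI)
  fix ys m d zs assume P: "P = ys @ replicate m d @ zs"
  have "directed_segment P (length ys) (length ys + m)"
    unfolding directed_segment_def P by (cases d) (auto simp: nth_append)
  from longest_dir_ge[OF this] show "m \<le> longest_dir P" by simp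
qed

lemma mono_copy_of_steps:
  assumes "length vs = Suc (length P)" "distinct vs"
    and "\<forall>t < length P. step (\<lambda>u v. T u v \<and> col u v = i) (P ! t) (vs ! t) (vs ! Suc t)"
  shows "mono_copy T col i P"
  unfolding mono_copy_def
proof (intro exI[of _ "\<lambda>t. vs ! t"] conjI allI impI)
  show "inj_on ((!) vs) {0..length P}"
    using assms(1,2) by (auto intro!: inj_on_nth)
  fix t assume "t < length P"
  with assms(3) show "if P ! t then T (vs ! t) (vs ! Suc t) \<and> col (vs ! t) (vs ! Suc t) = i
      else T (vs ! Suc t) (vs ! t) \<and> col (vs ! Suc t) (vs ! t) = i"
    by (cases "P ! t") auto
qed

section \<open>The upper bound\<close>

text \<open>Each eliminated colour \<open>j\<close> costs a factor \<open>64 * k * l j\<close>. A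
  surviving \<open>i\<close> is not among them, so their \<open>l j\<close> are absorbed by the
  product over the colours other than \<open>i\<close>, leaving the
  \<open>128 * k * length (Ps ! i)\<close> vertices that \<open>embed_in_dense_colour\<close>
  needs.\<close>

lemma ramsey_prop_upper:
  fixes Ps :: "bool list list"
  defines "k \<equiv> length Ps"
  assumes k: "1 \<le> k" and ne: "\<forall>i<k. Ps ! i \<noteq> []"
    and large: "\<And>i. i < k \<Longrightarrow> (64 * k) ^ k * (128 * k) *
      (length (Ps ! i) * (\<Prod>j\<in>{..<k} - {i}. longest_dir (Ps ! j))) \<le> N"
  shows "ramsey_prop Ps N"
  unfolding ramsey_prop_def
proof (intro allI impI)
  fix T :: "nat \<Rightarrow> nat \<Rightarrow> bool" and col :: "nat \<Rightarrow> nat \<Rightarrow> nat"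
  assume T: "tournament {0..<N} T" and col: "\<forall>x y. T x y \<longrightarrow> col x y < length Ps"
  define l where "l i = longest_dir (Ps ! i)" for i
  have l: "1 \<le> l i" if "i < k" for i using longest_dir_pos ne that by (simp add: l_def)
  obtain U I where UI: "U \<subseteq> {0..<N}" "I \<subseteq> {..<k}"
    and card_U: "card {0..<N} \<le> card U * (\<Prod>i\<in>{..<k} - I. 64 * k * l i)"
    and colU: "\<forall>x\<in>U. \<forall>y\<in>U. T x y \<longrightarrow> col x y \<in> I"
    and dense: "\<forall>i\<in>I. \<forall>W\<subseteq>U. card U \<le> 64 * k * l i * card W \<longrightarrow>
      (\<exists>u\<in>W. \<exists>v\<in>W. T u v \<and> col u v = i)"
    using colour_reduction[of "{..<k}" "{0..<N}" T col "\<lambda>i. 64 * k * l i"] col k_def by blast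
  have finU: "finite U" using UI(1) finite_subset by blast
  have N: "N \<le> (64 * k) ^ k * (card U * (\<Prod>i\<in>{..<k} - I. l i))"
  proof -
    have "(\<Prod>i\<in>{..<k} - I. 64 * k * l i) = (64 * k) ^ card ({..<k} - I) * (\<Prod>i\<in>{..<k} - I. l i)"
      by (simp add: prod.distrib)
    also have "\<dots> \<le> (64 * k) ^ k * (\<Prod>i\<in>{..<k} - I. l i)"
    proof (intro mult_le_mono1 power_increasing)
      show "card ({..<k} - I) \<le> k" using card_mono[of "{..<k}" "{..<k} - I"] by auto
    qed (use k in simp)
    finally have "card U * (\<Prod>i\<in>{..<k} - I. 64 * k * l i)
        \<le> card U * ((64 * k) ^ k * (\<Prod>i\<in>{..<k} - I. l i))" by (rule mult_le_mono2)
    also have "\<dots> = (64 * k) ^ k * (card U * (\<Prod>i\<in>{..<k} - I. l i))" by (rule mult.left_commute)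
    finally have "card U * (\<Prod>i\<in>{..<k} - I. 64 * k * l i)
        \<le> (64 * k) ^ k * (card U * (\<Prod>i\<in>{..<k} - I. l i))" .
    with card_U have "card {0..<N} \<le> (64 * k) ^ k * (card U * (\<Prod>i\<in>{..<k} - I. l i))"
      by (rule le_trans)
    then show ?thesis unfolding card_atLeastLessThan minus_nat.diff_0 .
  qed
  \<comment> \<open>Cancels the loss from colour reduction against \<open>large\<close>; applied
    with \<open>c = length (Ps ! i)\<close> for surviving \<open>i\<close>, and with
    \<open>c = 1\<close>.\<close>
  have large_U: "128 * k * c \<le> card U"
    if "i < k" and c: "c * (\<Prod>j\<in>{..<k} - I. l j) \<le> length (Ps ! i) * (\<Prod>j\<in>{..<k} - {i}. l j)" for i c
  proof -
    have "(64 * k) ^ k * (128 * k * (c * (\<Prod>j\<in>{..<k} - I. l j))) \<le>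
        (64 * k) ^ k * (128 * k * (length (Ps ! i) * (\<Prod>j\<in>{..<k} - {i}. l j)))"
      using c by (intro mult_le_mono2)
    also have "\<dots> \<le> N" using large[OF \<open>i < k\<close>] by (simp add: l_def mult.assoc)
    also note N
    finally have "(64 * k) ^ k * (128 * k * (c * (\<Prod>j\<in>{..<k} - I. l j)))
        \<le> (64 * k) ^ k * (card U * (\<Prod>j\<in>{..<k} - I. l j))" .
    moreover have "0 < (64 * k) ^ k" using k by simp
    ultimately have "128 * k * (c * (\<Prod>j\<in>{..<k} - I. l j)) \<le> card U * (\<Prod>j\<in>{..<k} - I. l j)"
      using mult_le_cancel1 by blast
    then have "128 * k * c * (\<Prod>j\<in>{..<k} - I. l j) \<le> card U * (\<Prod>j\<in>{..<k} - I. l j)"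
      by (simp only: mult.assoc)
    moreover have "0 < (\<Prod>j\<in>{..<k} - I. l j)" using l by (intro prod_pos) force
    ultimately show ?thesis using mult_le_cancel2 by blast
  qed
  have len: "128 * k * length (Ps ! i) \<le> card U" if "i \<in> I" for i
  proof (rule large_U)
    show "i < k" using that UI by auto
    have "(\<Prod>j\<in>{..<k} - I. l j) \<le> (\<Prod>j\<in>{..<k} - {i}. l j)"
      by (rule dvd_imp_le[OF prod_dvd_prod_subset])
        (use that l in \<open>auto intro!: prod_pos simp: Suc_le_eq\<close>)
    then show "length (Ps ! i) * (\<Prod>j\<in>{..<k} - I. l j)
        \<le> length (Ps ! i) * (\<Prod>j\<in>{..<k} - {i}. l j)" by (rule mult_le_mono2)
  qed
  \<comment> \<open>\<open>I\<close> is not yet known to be nonempty, so \<open>len\<close> alone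
    does not bound \<open>card U\<close>. Colour 0, surviving or not, yields two vertices in
    \<open>U\<close>, and then \<open>popular_colour\<close> produces a member of
    \<open>I\<close>.\<close>
  have "128 * k * 1 \<le> card U"
  proof (rule large_U)
    show "0 < k" using k by simp
    have "(\<Prod>j\<in>{..<k} - I. l j) \<le> (\<Prod>j<k. l j)"
      by (rule dvd_imp_le[OF prod_dvd_prod_subset])
        (use l in \<open>auto intro!: prod_pos simp: Suc_le_eq\<close>)
    also have "\<dots> = l 0 * (\<Prod>j\<in>{..<k} - {0}. l j)" using \<open>0 < k\<close> by (intro prod.remove) auto
    also have "\<dots> \<le> length (Ps ! 0) * (\<Prod>j\<in>{..<k} - {0}. l j)"
      unfolding l_def by (intro mult_le_mono1 longest_dir_le_length)
    finally show "1 * (\<Prod>j\<in>{..<k} - I. l j) \<le> length (Ps ! 0) * (\<Prod>j\<in>{..<k} - {0}. l j)" by simp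
  qed
  then have "2 \<le> card U" using k by linarith
  moreover have "\<forall>x\<in>U. \<forall>y\<in>U. x \<noteq> y \<longrightarrow> T x y \<or> T y x"
    using T UI(1) unfolding tournament_def by blast
  moreover have "finite I" "card I \<le> k"
    using UI(2) finite_subset card_mono[of "{..<k}" I] by auto
  ultimately obtain i where i: "i \<in> I"
    and many: "card U * card U \<le> 4 * k * card {(u, v) \<in> U \<times> U. T u v \<and> col u v = i}"
    using popular_colour[OF finU _ _ colU _ _ k] by blast
  have "i < k" using i UI by auto
  have "\<exists>vs. length vs = Suc (length (Ps ! i)) \<and> distinct vs \<and>
    (\<forall>t < length (Ps ! i). step (\<lambda>u v. T u v \<and> col u v = i) (Ps ! i ! t) (vs ! t) (vs ! Suc t))"
  proof (rule embed_in_dense_colour[OF finU _ many _ len[OF i] _ _ l[OF \<open>i < k\<close>] k])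
    show "\<not> (T x x \<and> col x x = i)" for x using T unfolding tournament_def by blast
    show "runs_le (l i) (Ps ! i)" unfolding l_def by (rule runs_le_longest_dir)
  qed (use dense i ne \<open>i < k\<close> in blast)+
  then show "\<exists>i<length Ps. mono_copy T col i (Ps ! i)"
    using mono_copy_of_steps \<open>i < k\<close> unfolding k_def by blast
qed

section \<open>The lower bound\<close>

text \<open>Cut the transitive tournament into nested blocks of sizes b 0 = 1, b 1, b 2, \dots, and
  colour an edge by the least level r such that both ends lie in the same block of size b (r + 1).
  Along a directed path of level r the blocks of size b r are distinct, and there are only
  b (r + 1) / b r of them. The lowest level moreover caps the number of vertices of any path,
  directed or not, so it is given to the colour m.\<close>

lemma not_ramsey_prop_lower:
  fixes Ps :: "bool list list"
  defines "k \<equiv> length Ps"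
  assumes ne: "\<forall>i<k. Ps ! i \<noteq> []" and "m < k"
    and N: "N \<le> length (Ps ! m) * (\<Prod>j\<in>{..<k} - {m}. longest_dir (Ps ! j))"
  shows "\<not> ramsey_prop Ps N"
proof
  assume ramsey: "ramsey_prop Ps N"
  \<comment> \<open>\<open>\<sigma>\<close> swaps 0 and \<open>m\<close>, so that level 0 receives
    colour \<open>m\<close>.\<close>
  define \<sigma> where "\<sigma> r = (if r = 0 then m else if r = m then 0 else r)" for r
  have \<sigma>_\<sigma>: "\<sigma> (\<sigma> r) = r" for r by (simp add: \<sigma>_def)
  have \<sigma>_less: "\<sigma> r < k" if "r < k" for r using that \<open>m < k\<close> by (simp add: \<sigma>_def)
  \<comment> \<open>The radix at level \<open>r\<close>: how many blocks of size \<open>b r\<close>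
    make up one of size \<open>b (Suc r)\<close>. It is one less than the number of vertices of the
    path for \<open>m\<close> at level 0, and of a longest directed subpath elsewhere.\<close>
  define a where "a r = (if r = 0 then length (Ps ! m) else longest_dir (Ps ! \<sigma> r))" for r
  have a_pos: "0 < a r" if "r < k" for r
    using ne \<open>m < k\<close> longest_dir_pos[of "Ps ! \<sigma> r"] \<sigma>_less[OF that] by (simp add: a_def)
  define b where "b r = (\<Prod>s<r. a s)" for r
  have b_Suc: "b (Suc r) = b r * a r" for r by (simp add: b_def)
  have "(\<Prod>j\<in>{..<k} - {0}. a j) = (\<Prod>j\<in>{..<k} - {m}. longest_dir (Ps ! j))"
  proof (rule prod.reindex_bij_witness[of _ \<sigma> \<sigma>])
    fix r assume "r \<in> {..<k} - {0}"
    then show "\<sigma> r \<in> {..<k} - {m}" "longest_dir (Ps ! \<sigma> r) = a r"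
      using \<sigma>_less by (auto simp: \<sigma>_def a_def split: if_splits)
  next
    fix r assume "r \<in> {..<k} - {m}"
    then show "\<sigma> r \<in> {..<k} - {0}"
      using \<sigma>_less by (auto simp: \<sigma>_def split: if_splits)
  qed (simp_all add: \<sigma>_\<sigma>)
  moreover have "b k = a 0 * (\<Prod>j\<in>{..<k} - {0}. a j)"
    unfolding b_def using \<open>m < k\<close> by (intro prod.remove) auto
  ultimately have Nb: "N \<le> b k" using N by (simp add: a_def)
  define lev where "lev x y = (LEAST r. x div b (Suc r) = y div b (Suc r))" for x y
  define T where "T x y \<longleftrightarrow> x < y \<and> y < N" for x y
  define col where "col x y = \<sigma> (lev x y)" for x y
  \<comment> \<open>All vertices below \<open>N \<le> b k\<close> lie in one block of size
    \<open>b k\<close>, so the \<open>LEAST\<close> in \<open>lev\<close> is attained, at a level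
    below \<open>k\<close>.\<close>
  have top: "x div b (Suc (k - 1)) = y div b (Suc (k - 1))" if "T x y" for x y
    using that Nb \<open>m < k\<close> by (simp add: T_def)
  have lev_less: "lev x y < k" if "T x y" for x y
    using Least_le[of "\<lambda>r. x div b (Suc r) = y div b (Suc r)", OF top[OF that]] \<open>m < k\<close>
    unfolding lev_def by linarith
  have same: "x div b (Suc (lev x y)) = y div b (Suc (lev x y))" if "T x y" for x y
    unfolding lev_def by (rule LeastI[of "\<lambda>r. x div b (Suc r) = y div b (Suc r)", OF top[OF that]])
  \<comment> \<open>At level 0 the blocks are single vertices; at higher levels, minimality of the
    level separates the two blocks.\<close>
  have incr: "x div b (lev x y) < y div b (lev x y)" if "T x y" for x y
  proof -
    have "x div b (lev x y) \<noteq> y div b (lev x y)"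
    proof (cases "lev x y")
      case 0
      then show ?thesis using that by (simp add: b_def T_def)
    next
      case (Suc r)
      then have "r < lev x y" by simp
      from not_less_Least[OF this[unfolded lev_def]] Suc show ?thesis by simp
    qed
    moreover have "x div b (lev x y) \<le> y div b (lev x y)"
      using that by (intro div_le_mono) (simp add: T_def)
    ultimately show ?thesis by simp
  qed
  have "tournament {0..<N} T" by (auto simp: tournament_def T_def)
  moreover have "\<forall>x y. T x y \<longrightarrow> col x y < length Ps"
    using lev_less \<sigma>_less by (simp add: col_def k_def)
  ultimately obtain i where "i < k" "mono_copy T col i (Ps ! i)"
    using ramsey unfolding ramsey_prop_def k_def by blast
  then obtain f where inj: "inj_on f {0..length (Ps ! i)}"
    and f: "\<And>t. t < length (Ps ! i) \<Longrightarrow>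
      if Ps ! i ! t then T (f t) (f (Suc t)) \<and> col (f t) (f (Suc t)) = i
      else T (f (Suc t)) (f t) \<and> col (f (Suc t)) (f t) = i"
    unfolding mono_copy_def by blast
  define r where "r = \<sigma> i"
  \<comment> \<open>\<open>g t\<close> indexes the block of size \<open>b r\<close> containing
    \<open>f t\<close>. By \<open>div_mult2_eq\<close>, \<open>g t div a r\<close> indexes the
    enclosing block of size \<open>b (Suc r)\<close>, which is constant along the copy because every
    edge has level \<open>r\<close>.\<close>
  define g where "g t = f t div b r" for t
  have "r < k" using \<sigma>_less[OF \<open>i < k\<close>] by (simp add: r_def)
  have lev: "lev x y = r" if "col x y = i" for x y using that \<sigma>_\<sigma> unfolding col_def r_def by metis
  have g_Suc: "g t div a r = g (Suc t) div a r" "if Ps ! i ! t then g t < g (Suc t) else g (Suc t) < g t"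
    if "t < length (Ps ! i)" for t
    using f[OF that] lev same incr unfolding g_def div_mult2_eq[symmetric] b_Suc[symmetric]
    by (metis, metis)
  have g_const: "g t div a r = g 0 div a r" if "t \<le> length (Ps ! i)" for t
    using that by (induction t) (use g_Suc(1) in auto)
  show False
  proof (cases "r = 0")
    case True
    then have "i = m" using \<sigma>_\<sigma>[of i] by (simp add: r_def \<sigma>_def)
    have ga: "g = f" "a r = length (Ps ! i)" using True \<open>i = m\<close> by (auto simp: g_def b_def a_def)
    \<comment> \<open>All \<open>length (Ps ! i) + 1\<close> vertices of the copy fall into an
      interval of only \<open>length (Ps ! i)\<close> vertices.\<close>
    define q where "q = f 0 div a r"
    have "f t \<in> {q * a r..<q * a r + a r}" if "t \<le> length (Ps ! i)" for t
    proof -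
      have "f t div a r = q" using g_const[OF that] by (simp add: q_def ga)
      then have "f t = q * a r + f t mod a r" by (metis div_mult_mod_eq)
      moreover have "f t mod a r < a r" using a_pos[OF \<open>r < k\<close>] by simp
      ultimately show ?thesis by auto
    qed
    then have "f ` {0..length (Ps ! i)} \<subseteq> {q * a r..<q * a r + a r}" by auto
    then have "card (f ` {0..length (Ps ! i)}) \<le> a r"
      using card_mono[of "{q * a r..<q * a r + a r}"] by fastforce
    then show False using card_image[OF inj] by (simp add: ga)
  next
    case False
    then have ar: "a r = longest_dir (Ps ! i)" using \<sigma>_\<sigma> by (simp add: a_def r_def)
    \<comment> \<open>Along a longest directed segment \<open>g\<close> is strictly monotone, so
      over its \<open>a r\<close> edges it moves by at least \<open>a r\<close> and leaves the
      enclosing block.\<close>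
    obtain u v where seg: "directed_segment (Ps ! i) u v" and uv: "a r = v - u"
      using longest_dir_attained ar by metis
    have le: "u \<le> v" "v \<le> length (Ps ! i)" using seg by (auto simp: directed_segment_def)
    have gap: False if "x + a r \<le> y" "x div a r = y div a r" for x y
    proof -
      have "(x + a r) div a r \<le> y div a r" using that(1) by (rule div_le_mono)
      then show False using that(2) a_pos[OF \<open>r < k\<close>] by simp
    qed
    have uv': "v = u + a r" using uv le by simp
    have eq: "g u div a r = g v div a r" using g_const[of u] g_const[of v] le by simp
    from seg consider "\<forall>t. u \<le> t \<and> t < v \<longrightarrow> Ps ! i ! t" | "\<forall>t. u \<le> t \<and> t < v \<longrightarrow> \<not> Ps ! i ! t"
      unfolding directed_segment_def by blast
    then show False
    proof cases
      case 1
      have "g u + n \<le> g (u + n)" if "n \<le> a r" for n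
        using that
      proof (induction n)
        case (Suc n)
        then have "u \<le> u + n \<and> u + n < v" using uv' by simp
        then have "g (u + n) < g (Suc (u + n))" using g_Suc(2)[of "u + n"] 1 le by auto
        then show ?case using Suc by simp
      qed simp
      from gap[OF this[OF order_refl]] eq show False by (simp add: uv')
    next
      case 2
      have "g (u + n) + n \<le> g u" if "n \<le> a r" for n
        using that
      proof (induction n)
        case (Suc n)
        then have "u \<le> u + n \<and> u + n < v" using uv' by simp
        then have "g (Suc (u + n)) < g (u + n)" using g_Suc(2)[of "u + n"] 2 le by auto
        then show ?case using Suc by simp
      qed simp
      from gap[OF this[OF order_refl]] eq show False by (simp add: uv')
    qed
  qed
qed

section \<open>Combining the two bounds\<close>

theorem mainTheorem3:
  "\<forall>k \<ge> (1::nat). \<exists>c > (0::real). \<forall>Ps :: bool list list.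
     length Ps = k \<longrightarrow> (\<forall>i < k. Ps ! i \<noteq> []) \<longrightarrow>
     (\<exists>N. ramsey_prop Ps N) \<and>
     (\<Prod>i<k. real (longest_dir (Ps ! i))) *
        (MAX i \<in> {..<k}. real (path_len (Ps ! i)) / real (longest_dir (Ps ! i)))
       \<le> real (RT Ps) \<and>
     real (RT Ps) \<le> c * (\<Prod>i<k. real (longest_dir (Ps ! i))) *
        (MAX i \<in> {..<k}. real (path_len (Ps ! i)) / real (longest_dir (Ps ! i)))"
proof (intro allI impI)
  fix k :: nat assume k: "1 \<le> k"
  define C where "C = (64 * k) ^ k * (128 * k)"
  show "\<exists>c > (0::real). \<forall>Ps :: bool list list.
     length Ps = k \<longrightarrow> (\<forall>i < k. Ps ! i \<noteq> []) \<longrightarrow>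
     (\<exists>N. ramsey_prop Ps N) \<and>
     (\<Prod>i<k. real (longest_dir (Ps ! i))) *
        (MAX i \<in> {..<k}. real (path_len (Ps ! i)) / real (longest_dir (Ps ! i)))
       \<le> real (RT Ps) \<and>
     real (RT Ps) \<le> c * (\<Prod>i<k. real (longest_dir (Ps ! i))) *
        (MAX i \<in> {..<k}. real (path_len (Ps ! i)) / real (longest_dir (Ps ! i)))"
  proof (intro exI[of _ "real C"] conjI allI impI)
    show "0 < real C" using k by (simp add: C_def)
    fix Ps :: "bool list list"
    assume len: "length Ps = k" and ne: "\<forall>i<k. Ps ! i \<noteq> []"
    define l where "l i = longest_dir (Ps ! i)" for i
    define ratio where "ratio i = real (path_len (Ps ! i)) / real (l i)" for i
    \<comment> \<open>The integer form of the product of all \<open>l j\<close> times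
      \<open>ratio i\<close>, in which both Ramsey lemmas are phrased.\<close>
    define D where "D i = length (Ps ! i) * (\<Prod>j\<in>{..<k} - {i}. l j)" for i
    have l: "0 < l i" if "i < k" for i
      using longest_dir_pos[of "Ps ! i"] ne that by (simp add: l_def)
    have prod_ratio: "(\<Prod>j<k. real (l j)) * ratio i = real (D i)" if "i < k" for i
    proof -
      have "(\<Prod>j<k. real (l j)) = real (l i) * (\<Prod>j\<in>{..<k} - {i}. real (l j))"
        using that by (intro prod.remove) auto
      then show ?thesis using l[OF that] by (simp add: ratio_def D_def path_len_def)
    qed
    define M where "M = (MAX i \<in> {..<k}. ratio i)"
    have "M \<in> ratio ` {..<k}" unfolding M_def using k by (intro Max_in) (auto simp: lessThan_empty_iff)
    then obtain m where m: "m < k" "M = ratio m" by auto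
    \<comment> \<open>A maximiser of the ratio also maximises \<open>D\<close>, so one number meets
      the size condition of every colour.\<close>
    have "D i \<le> D m" if "i < k" for i
    proof -
      have "ratio i \<le> M" unfolding M_def using that by (intro Max_ge) auto
      then have "(\<Prod>j<k. real (l j)) * ratio i \<le> (\<Prod>j<k. real (l j)) * ratio m"
        unfolding m(2) by (intro mult_left_mono prod_nonneg) auto
      then show ?thesis using prod_ratio[OF that] prod_ratio[OF m(1)] by simp
    qed
    then have "C * D i \<le> C * D m" if "i < k" for i using that by simp
    then have upper: "ramsey_prop Ps (C * D m)"
      using ramsey_prop_upper[of Ps "C * D m"] k ne by (simp add: len C_def D_def l_def)
    then have "RT Ps \<le> C * D m" unfolding RT_def by (rule Least_le)
    moreover have "ramsey_prop Ps (RT Ps)" unfolding RT_def using upper by (rule LeastI)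
    \<comment> \<open>\<open>not_ramsey_prop_lower\<close> refutes every number up to and including
      \<open>D m\<close>.\<close>
    then have "D m < RT Ps"
      using not_ramsey_prop_lower[of Ps m "RT Ps"] ne m(1) by (force simp: len D_def l_def)
    ultimately have "real (D m) \<le> real (RT Ps)" "real (RT Ps) \<le> real C * real (D m)"
      by (simp_all flip: of_nat_mult)
    then have bounds: "(\<Prod>j<k. real (l j)) * M \<le> real (RT Ps)"
      "real (RT Ps) \<le> real C * (\<Prod>j<k. real (l j)) * M"
      by (simp_all add: m(2) prod_ratio[OF m(1)] mult.assoc)
    show "\<exists>N. ramsey_prop Ps N" using upper by blast
    show "(\<Prod>i<k. real (longest_dir (Ps ! i))) *
        (MAX i \<in> {..<k}. real (path_len (Ps ! i)) / real (longest_dir (Ps ! i)))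
       \<le> real (RT Ps)"
      using bounds(1) unfolding M_def ratio_def l_def .
    show "real (RT Ps) \<le> real C * (\<Prod>i<k. real (longest_dir (Ps ! i))) *
        (MAX i \<in> {..<k}. real (path_len (Ps ! i)) / real (longest_dir (Ps ! i)))"
      using bounds(2) unfolding M_def ratio_def l_def .
  qed
qed

end
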